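(* Let $s_0,s_f,v_0,v_f\in\mathbb{R}$ and suppose that $s_f-s_0\neq (v_0+v_f)/2$. For $0<a<a_c$, let $t_s$ be the switching time of the best approximation control $u_{\mathcal{B}}$ of the infeasible double integrator problem with control bound $a$ (all defined in the context). Then, as $a\to0$, $$t_s\to\frac{2v_0+v_f-3(s_f-s_0)}{3(v_0+v_f)-6(s_f-s_0)}.$$
   Context: For $a>0$ let $$\mathcal{A}=\{u\in\mathcal{L}^2([0,1];\mathbb{R}):\ \exists\,x_1,x_2\in W^{1,2}([0,1];\mathbb{R}),\ \dot x_1=x_2,\ \dot x_2=u \text{ a.e. on }[0,1],\ x_1(0)=s_0,\ x_1(1)=s_f,\ x_2(0)=v_0,\ x_2(1)=v_f\},$$ $$\mathcal{B}=\{u\in\mathcal{L}^2([0,1];\mathbb{R}):\ |u(t)|\le a\ \text{for a.e. } t\in[0,1]\},$$ where $W^{1,2}([0,1];\mathbb{R})$ is the Sobolev space of absolutely continuous functions $z\in\mathcal{L}^2$ with $\dot z\in\mathcal{L}^2$. The critical value $a_c$ is such that $\mathcal{A}\cap\mathcal{B}\neq\varnothing$ when $a=a_c$ and $\mathcal{A}\cap\mathcal{B}=\varnothing$ when $a<a_c$. For $0<a<a_c$, $(u_{\mathcal{A}},u_{\mathcal{B}})$ is a best approximation pair, i.e. a minimizer of $\frac12\|u_{\mathcal{A}}-u_{\mathcal{B}}\|_{\mathcal{L}^2}^2$ over $\mathcal{A}\times\mathcal{B}$, and $v=u_{\mathcal{A}}-u_{\mathcal{B}}$ is the optimal gap function.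 It is known that $v(t)=c_1t+c_2$ on $[0,1]$ with real constants $c_1,c_2$ (depending on $a$ and the boundary data), not both zero, and that for a.e. $t$, $u_{\mathcal{B}}(t)=a$ if $v(t)\ge 0$ and $u_{\mathcal{B}}(t)=-a$ if $v(t)<0$. Switching time and conventions: when $c_1,c_2$ are nonzero and $v(0)=c_2$ and $v(1)=c_1+c_2$ have opposite signs (or $v(1)=0$), the switching time is the value $t_s\in(0,1]$ with $v(t_s)=0$; $t_s=1$ when $v(1)=0$. When $c_1\ne0$ and $c_2=0$ one sets $t_s=0$. When $c_1,c_2$ are nonzero and $v$ has no zero in $[0,1]$, $u_{\mathcal{B}}$ is the constant $\operatorname{sgn}(c_2)a$, which does not change if one sets $c_1:=-c_2$, so that $v(1)=0$; by this convention $u_{\mathcal{B}}$ is represented with $t_s=1$. With $s_f-s_0\ne(v_0+v_f)/2$, the best approximation control is represented as $u_{\mathcal{B}}(t)=r$ for $0\le t<t_s$ and $u_{\mathcal{B}}(t)=-r$ for $t_s\le t\le1$. If $v_0\ne v_f$, then $r=-\operatorname{sgn}(c_1)a$ and $c_1,t_s$ solve $$(2r-c_1)t_s+\tfrac12c_1-v_f+v_0-r=0,\qquad (r-c_1)t_s^2+(v_0-v_f+c_1-r)t_s-\tfrac13c_1+\tfrac12r+v_f+s_0-s_f=0;$$ if $v_0=v_f$, then $t_s=\tfrac12$ and $r\in\{a,-a\}$.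
   Formalization: For v_0≠v_f the two equations for c_1, t_s are an explicit hypothesis for all 0<a<a_c; they fail for small a when the stated limit lies outside [0,1] (e.g. s_0=0, s_f=2/5, v_0=0, v_f=1, limit −1/3), where the claim is false since t_s∈[0,1]. *)

theory Defs
  imports "HOL-Analysis.Analysis"
begin

text \<open>Elements of \<open>L\<^sup>2\<close> and \<open>W\<^sup>1\<^sup>,\<^sup>2\<close> over \<open>[0,1]\<close> are represented by functions on \<open>real\<close>, not by
  classes modulo almost-everywhere equality; values outside \<open>[0,1]\<close> are irrelevant.\<close>

definition L2 :: "(real \<Rightarrow> real) set" where
  "L2 = {u. u \<in> borel_measurable (lebesgue_on {0..1}) \<and>
            integrable (lebesgue_on {0..1}) (\<lambda>t. (u t)\<^sup>2)}"

definition norm_L2 :: "(real \<Rightarrow> real) \<Rightarrow> real" where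
  "norm_L2 u = sqrt (LINT t|lebesgue_on {0..1}. (u t)\<^sup>2)"

definition abs_continuous_on :: "real \<Rightarrow> real \<Rightarrow> (real \<Rightarrow> real) \<Rightarrow> bool" where
  "abs_continuous_on l u z \<longleftrightarrow>
     (\<forall>\<epsilon>>0. \<exists>\<delta>>0. \<forall>(n::nat) p q.
        (\<forall>i<n. l \<le> p i \<and> p i \<le> q i \<and> q i \<le> u) \<and>
        (\<forall>i<n. \<forall>j<n. i \<noteq> j \<longrightarrow> {p i<..<q i} \<inter> {p j<..<q j} = {}) \<and>
        (\<Sum>i<n. q i - p i) < \<delta>
        \<longrightarrow> (\<Sum>i<n. \<bar>z (q i) - z (p i)\<bar>) < \<epsilon>)"

definition ae_derivative :: "(real \<Rightarrow> real) \<Rightarrow> (real \<Rightarrow> real) \<Rightarrow> bool" where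
  "ae_derivative z g \<longleftrightarrow>
     (AE t in lebesgue_on {0..1}. (z has_real_derivative g t) (at t within {0..1}))"

definition W12 :: "(real \<Rightarrow> real) set" where
  "W12 = {z. abs_continuous_on 0 1 z \<and> z \<in> L2 \<and> (\<exists>g\<in>L2. ae_derivative z g)}"

definition set_A :: "real \<Rightarrow> real \<Rightarrow> real \<Rightarrow> real \<Rightarrow> (real \<Rightarrow> real) set" where
  "set_A s0 sf v0 vf =
     {u \<in> L2. \<exists>x1\<in>W12. \<exists>x2\<in>W12. ae_derivative x1 x2 \<and> ae_derivative x2 u \<and>
        x1 0 = s0 \<and> x1 1 = sf \<and> x2 0 = v0 \<and> x2 1 = vf}"

definition set_B :: "real \<Rightarrow> (real \<Rightarrow> real) set" where
  "set_B a = {u \<in> L2. AE t in lebesgue_on {0..1}. \<bar>u t\<bar> \<le> a}"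

definition critical_value :: "real \<Rightarrow> real \<Rightarrow> real \<Rightarrow> real \<Rightarrow> real \<Rightarrow> bool" where
  "critical_value s0 sf v0 vf ac \<longleftrightarrow>
     0 < ac \<and> set_A s0 sf v0 vf \<inter> set_B ac \<noteq> {} \<and>
     (\<forall>a. 0 < a \<and> a < ac \<longrightarrow> set_A s0 sf v0 vf \<inter> set_B a = {})"

definition best_approximation_pair ::
    "(real \<Rightarrow> real) set \<Rightarrow> (real \<Rightarrow> real) set \<Rightarrow> (real \<Rightarrow> real) \<Rightarrow> (real \<Rightarrow> real) \<Rightarrow> bool" where
  "best_approximation_pair A B uA uB \<longleftrightarrow> uA \<in> A \<and> uB \<in> B \<and>
     (\<forall>wA\<in>A. \<forall>wB\<in>B.
        (1/2) * (norm_L2 (\<lambda>t. uA t - uB t))\<^sup>2 \<le> (1/2) * (norm_L2 (\<lambda>t. wA t - wB t))\<^sup>2)"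

text \<open>In the next two definitions \<open>c1\<close> and \<open>c2\<close> are the coefficients of the gap function
  \<open>v(t) = c1 t + c2\<close>.  If \<open>v\<close> has no zero in \<open>[0,1]\<close>, then \<open>u\<^sub>B\<close> is constant and is represented with
  \<open>c1\<close> replaced by \<open>- c2\<close>, so that the switching time is \<open>1\<close>.  The case \<open>c1 = 0\<close> cannot occur for a best
  approximation pair when \<open>sf - s0 \<noteq> (v0 + vf) / 2\<close>; the values given to it here are irrelevant.\<close>

definition slope :: "real \<Rightarrow> real \<Rightarrow> real" where
  "slope c1 c2 = (if \<exists>t\<in>{0..1}. c1 * t + c2 = 0 then c1 else - c2)"

definition switching_time :: "real \<Rightarrow> real \<Rightarrow> real" where
  "switching_time c1 c2 =
     (if c2 = 0 then 0
      else if \<exists>t\<in>{0..1}. c1 * t + c2 = 0 then (THE t. t \<in> {0<..1} \<and> c1 * t + c2 = 0)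
      else 1)"

text \<open>The conditions that \<open>u\<^sub>B + v\<close> lies in \<open>set_A s0 sf v0 vf\<close>, written out for
  \<open>v(t) = c1 (t - ts)\<close> and \<open>u\<^sub>B = r\<close> on \<open>[0,ts)\<close>, \<open>u\<^sub>B = - r\<close> on \<open>[ts,1]\<close>.\<close>

definition switching_equations ::
    "real \<Rightarrow> real \<Rightarrow> real \<Rightarrow> real \<Rightarrow> real \<Rightarrow> real \<Rightarrow> real \<Rightarrow> bool" where
  "switching_equations s0 sf v0 vf r c1 ts \<longleftrightarrow>
     (2 * r - c1) * ts + (1/2) * c1 - vf + v0 - r = 0 \<and>
     (r - c1) * ts\<^sup>2 + (v0 - vf + c1 - r) * ts - (1/3) * c1 + (1/2) * r + vf + s0 - sf = 0"

end

theory Submission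
  imports Defs
begin

text \<open>
  If \<open>v0 \<noteq> vf\<close>, multiplying the first switching equation by \<open>ts\<close> eliminates \<open>c1 ts\<^sup>2\<close> from the second.
  What remains is a linear system for \<open>c1\<close> and \<open>c1 ts\<close>, up to terms of size at most a constant times
  \<open>\<bar>r\<bar> = a\<close>. Letting \<open>a \<rightarrow> 0\<close> gives \<open>c1 \<rightarrow> 6 (v0 + vf) - 12 (sf - s0) \<noteq> 0\<close> and the limit of \<open>ts\<close>.

  If \<open>v0 = vf\<close>, membership of \<open>uA\<close> in \<open>set_A\<close> prescribes the moments of \<open>uA\<close> against \<open>1\<close> and \<open>1 - t\<close>.
  Since \<open>uA - uB\<close> is affine and \<open>\<bar>uB\<bar> \<le> a\<close>, the same two moments of the affine gap function differ
  from the prescribed ones by at most \<open>a\<close>, so \<open>c1\<close> and \<open>c2\<close> converge and \<open>- c2 / c1 \<rightarrow> 1/2\<close>. The moments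
  require the fundamental theorem of calculus for absolutely continuous functions, which the
  gauge integral makes accessible: around points of the exceptional null set, take the gauge to be
  an open set of small measure, so that absolute continuity bounds the contribution of these tags.
\<close>

section \<open>Null sets and total lengths of tagged intervals\<close>

lemma AE_lebesgue_on_negligible:
  fixes S :: "'a::euclidean_space set"
  assumes "S \<in> sets lebesgue"
  shows "(AE x in lebesgue_on S. P x) \<longleftrightarrow> negligible {x \<in> S. \<not> P x}"
proof -
  have "(AE x in lebesgue_on S. P x) \<longleftrightarrow> (AE x in lebesgue. x \<in> S \<longrightarrow> P x)"
    using assms by (intro AE_restrict_space_iff) simp
  also have "\<dots> \<longleftrightarrow> negligible {x \<in> S. \<not> P x}"
    by (auto simp: eventually_ae_filter_negligible intro: negligible_subset)
  finally show ?thesis .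
qed

text \<open>Outer regularity makes \<open>U - N\<close> small, and deleting the null set
  \<open>N\<close> from \<open>U\<close> does not change its measure.\<close>

lemma negligible_outer_open:
  fixes N :: "'a::euclidean_space set"
  assumes "negligible N" "e > 0"
  obtains U where "open U" "N \<subseteq> U" "U \<in> lmeasurable" "measure lebesgue U < e"
proof -
  have N: "N \<in> null_sets lebesgue"
    using assms(1) negligible_iff_null_sets by blast
  obtain U where U: "open U" "N \<subseteq> U" "U - N \<in> lmeasurable" "emeasure lebesgue (U - N) < ennreal e"
    using sets_lebesgue_outer_open[OF null_setsD2[OF N] assms(2)] by blast
  have "emeasure lebesgue U = emeasure lebesgue (U - N)"
    using U(1) by (intro emeasure_Diff_null_set[OF N, symmetric]) simp
  then have "emeasure lebesgue U < ennreal e" using U by simp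
  moreover from this have "U \<in> lmeasurable"
    using U(1) by (intro fmeasurableI) (auto simp: less_top[symmetric] intro: order_less_trans)
  ultimately show ?thesis
    using U that assms(2) by (auto simp: emeasure_eq_measure2 ennreal_less_iff)
qed

text \<open>Intersections of distinct intervals of the division are convex with empty interior,
  hence negligible. The lengths therefore add up to the measure of the union, which lies in
  \<open>U\<close>.\<close>

lemma sum_content_tagged_partial_division_le:
  fixes U :: "real set"
  assumes p: "p tagged_partial_division_of S" and U: "U \<in> lmeasurable"
    and sub: "\<And>x K. (x, K) \<in> p \<Longrightarrow> K \<subseteq> U"
  shows "(\<Sum>(x,K)\<in>p. measure lborel K) \<le> measure lebesgue U"
proof -
  note P = tagged_partial_division_ofD[OF p]
  have lm: "snd y \<in> lmeasurable" if "y \<in> p" for y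
    using P(4)[of "fst y" "snd y"] that by auto
  have "pairwise (\<lambda>y z. negligible (snd y \<inter> snd z)) p"
    unfolding pairwise_def
  proof (intro ballI impI)
    fix y z assume yz: "y \<in> p" "z \<in> p" "y \<noteq> z"
    obtain a b c d where "snd y = cbox a b" "snd z = cbox c d"
      using yz P(4) by (metis prod.collapse)
    then have "convex (snd y \<inter> snd z)"
      by (metis convex_Int convex_box(1))
    moreover have "interior (snd y \<inter> snd z) = {}"
      using P(5)[of "fst y" "snd y" "fst z" "snd z"] yz by simp
    ultimately show "negligible (snd y \<inter> snd z)"
      using negligible_convex_interior by blast
  qed
  then have "(\<Sum>y\<in>p. measure lebesgue (snd y)) = measure lebesgue (\<Union>(snd ` p))"
    using measure_negligible_finite_Union_image[OF P(1), of snd] lm by metis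
  also have "\<dots> \<le> measure lebesgue U"
  proof (rule measure_mono_fmeasurable[OF _ _ U])
    show "\<Union>(snd ` p) \<subseteq> U" by (intro UN_least) (metis prod.collapse sub)
    show "\<Union>(snd ` p) \<in> sets lebesgue"
      by (intro sets.finite_Union finite_imageI P(1) image_subsetI fmeasurableD lm)
  qed
  also have "(\<Sum>y\<in>p. measure lebesgue (snd y)) = (\<Sum>(x,K)\<in>p. measure lborel K)"
  proof (rule sum.cong[OF refl], clarify)
    fix x K assume "(x, K) \<in> p"
    then obtain a b where "K = cbox a b" using P(4) by blast
    then show "measure lebesgue (snd (x, K)) = measure lborel K" by simp
  qed
  finally show ?thesis .
qed

section \<open>Absolute continuity along tagged partial divisions\<close>

lemma abs_continuous_onE:
  assumes "abs_continuous_on a b f" "e > 0"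
  obtains d where "d > 0" "\<And>(n::nat) l u.
        (\<And>i. i < n \<Longrightarrow> a \<le> l i \<and> l i \<le> u i \<and> u i \<le> b) \<Longrightarrow>
        (\<And>i j. i < n \<Longrightarrow> j < n \<Longrightarrow> i \<noteq> j \<Longrightarrow> {l i<..<u i} \<inter> {l j<..<u j} = {}) \<Longrightarrow>
        (\<Sum>i<n. u i - l i) < d \<Longrightarrow> (\<Sum>i<n. \<bar>f (u i) - f (l i)\<bar>) < e"
proof -
  obtain d where "d > 0" and d: "\<forall>(n::nat) l u.
        (\<forall>i<n. a \<le> l i \<and> l i \<le> u i \<and> u i \<le> b) \<and>
        (\<forall>i<n. \<forall>j<n. i \<noteq> j \<longrightarrow> {l i<..<u i} \<inter> {l j<..<u j} = {}) \<and>
        (\<Sum>i<n. u i - l i) < d \<longrightarrow> (\<Sum>i<n. \<bar>f (u i) - f (l i)\<bar>) < e"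
    using assms(1)[unfolded abs_continuous_on_def, rule_format, OF assms(2)] by (elim exE conjE)
  show ?thesis
    by (rule that[OF \<open>d > 0\<close>], rule d[rule_format]) blast
qed

text \<open>This translates between indexed families of endpoints, as in the definition of absolute
  continuity, and the finite sets of tagged intervals of the gauge integral. An enumeration of
  \<open>p\<close> turns disjoint interiors into disjoint open intervals.\<close>

lemma abs_continuous_on_tagged_partial_division:
  assumes "abs_continuous_on a b f" "e > 0"
  obtains d where "d > 0"
    "\<And>p. p tagged_partial_division_of {a..b} \<Longrightarrow> (\<Sum>(x,K)\<in>p. measure lborel K) < d \<Longrightarrow>
       (\<Sum>(x,K)\<in>p. \<bar>f (Sup K) - f (Inf K)\<bar>) < e"
proof -
  obtain d where "d > 0" and d: "\<And>(n::nat) l u.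
        (\<And>i. i < n \<Longrightarrow> a \<le> l i \<and> l i \<le> u i \<and> u i \<le> b) \<Longrightarrow>
        (\<And>i j. i < n \<Longrightarrow> j < n \<Longrightarrow> i \<noteq> j \<Longrightarrow> {l i<..<u i} \<inter> {l j<..<u j} = {}) \<Longrightarrow>
        (\<Sum>i<n. u i - l i) < d \<Longrightarrow> (\<Sum>i<n. \<bar>f (u i) - f (l i)\<bar>) < e"
    by (rule abs_continuous_onE[OF assms]) blast
  show ?thesis
  proof
    fix p assume p: "p tagged_partial_division_of {a..b}" and less: "(\<Sum>(x,K)\<in>p. measure lborel K) < d"
    note P = tagged_partial_division_ofD[OF p]
    obtain h where h: "bij_betw h {..<card p} p"
      using ex_bij_betw_nat_finite[OF P(1)] by (metis atLeast0LessThan)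
    have sum_h: "(\<Sum>y\<in>p. g y) = (\<Sum>i<card p. g (h i))" for g :: "real \<times> real set \<Rightarrow> real"
      by (rule sum.reindex_bij_betw[OF h, symmetric])
    define l u where "l i = Inf (snd (h i))" and "u i = Sup (snd (h i))" for i
    have K: "snd (h i) = {l i..u i}" "l i \<le> u i" "a \<le> l i" "u i \<le> b" if "i < card p" for i
    proof -
      have hp: "(fst (h i), snd (h i)) \<in> p"
        using h that by (auto simp: bij_betw_def)
      obtain s t where st: "snd (h i) = {s..t}"
        using P(4)[OF hp] by auto
      have "s \<le> t" using P(2)[OF hp] st by auto
      then show "snd (h i) = {l i..u i}" "l i \<le> u i" "a \<le> l i" "u i \<le> b"
        using P(3)[OF hp] st by (auto simp: l_def u_def)
    qed
    have "(\<Sum>i<card p. \<bar>f (u i) - f (l i)\<bar>) < e"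
    proof (rule d)
      fix i j assume ij: "i < card p" "j < card p" "i \<noteq> j"
      show "{l i<..<u i} \<inter> {l j<..<u j} = {}"
      proof -
        from ij have "h i \<in> p" "h j \<in> p" "h i \<noteq> h j"
          using h by (auto simp: bij_betw_def inj_on_def)
        then have "interior (snd (h i)) \<inter> interior (snd (h j)) = {}"
          using P(5) by (metis prod.collapse)
        then show "{l i<..<u i} \<inter> {l j<..<u j} = {}"
          using K ij by simp
      qed
    next
      show "(\<Sum>i<card p. u i - l i) < d"
        using less K by (simp add: sum_h split_def)
    qed (use K in auto)
    then show "(\<Sum>(x,K)\<in>p. \<bar>f (Sup K) - f (Inf K)\<bar>) < e"
      by (simp add: sum_h split_def l_def u_def)
  qed (use \<open>d > 0\<close> in auto)
qed

section \<open>The fundamental theorem of calculus for absolutely continuous functions\<close>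

theorem fundamental_theorem_of_calculus_abs_continuous:
  fixes f f' :: "real \<Rightarrow> real"
  assumes "a < b" and ac: "abs_continuous_on a b f" and N: "negligible N"
    and deriv: "\<And>x. x \<in> {a..b} - N \<Longrightarrow> (f has_real_derivative f' x) (at x within {a..b})"
  shows "(f' has_integral (f b - f a)) {a..b}"
proof -
  \<comment> \<open>Setting the integrand to \<open>0\<close> on \<open>N\<close> leaves its
    integral unchanged, and a tag in \<open>N\<close> then contributes only the increment of
    \<open>f\<close> to the error.\<close>
  define g where "g x = (if x \<in> N then 0 else f' x)" for x
  have "(g has_integral (f b - f a)) {a..b}"
    unfolding has_integral_factor_content_real
  proof (intro allI impI)
    fix e :: real assume "e > 0"
    have "\<forall>x. \<exists>d>0. x \<in> {a..b} - N \<longrightarrow>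
         (\<forall>y\<in>{a..b}. \<bar>y-x\<bar> < d \<longrightarrow> \<bar>f y - f x - (y-x) * f' x\<bar> \<le> e/2 * \<bar>y-x\<bar>)"
    proof
      fix x
      show "\<exists>d>0. x \<in> {a..b} - N \<longrightarrow>
         (\<forall>y\<in>{a..b}. \<bar>y-x\<bar> < d \<longrightarrow> \<bar>f y - f x - (y-x) * f' x\<bar> \<le> e/2 * \<bar>y-x\<bar>)"
      proof (cases "x \<in> {a..b} - N")
        case True
        from deriv[OF this] show ?thesis
          using \<open>e > 0\<close> half_gt_zero[OF \<open>e > 0\<close>]
          unfolding has_field_derivative_def has_derivative_within_alt real_norm_def
          by (metis mult.commute)
      qed (auto intro: exI[of _ 1])
    qed
    then obtain d where d: "\<And>x. 0 < d x"
      "\<And>x y. \<lbrakk>x \<in> {a..b} - N; y \<in> {a..b}; \<bar>y-x\<bar> < d x\<rbrakk>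
            \<Longrightarrow> \<bar>f y - f x - (y-x) * f' x\<bar> \<le> e/2 * \<bar>y-x\<bar>"
      by metis
    \<comment> \<open>The admissible error \<open>e * (b - a)\<close> is split evenly: one half for
      the tags outside \<open>N\<close>, where \<open>f\<close> is differentiable, the other for the
      tags in \<open>N\<close>.\<close>
    have epos: "e/2 * (b - a) > 0" using \<open>e > 0\<close> \<open>a < b\<close> by simp
    obtain \<delta> where "\<delta> > 0" and \<delta>:
      "\<And>p. p tagged_partial_division_of {a..b} \<Longrightarrow> (\<Sum>(x,K)\<in>p. measure lborel K) < \<delta> \<Longrightarrow>
       (\<Sum>(x,K)\<in>p. \<bar>f (Sup K) - f (Inf K)\<bar>) < e/2 * (b - a)"
      by (rule abs_continuous_on_tagged_partial_division[OF ac epos]) blast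
    obtain U where U: "open U" "N \<subseteq> U" "U \<in> lmeasurable" "measure lebesgue U < \<delta>"
      by (rule negligible_outer_open[OF N \<open>\<delta> > 0\<close>])
    \<comment> \<open>All tags in \<open>N\<close> share the same set \<open>U\<close>, so their
      intervals have total length below \<open>\<delta>\<close>, however many there are.\<close>
    let ?\<gamma> = "\<lambda>x. if x \<in> N then U else ball x (d x)"
    show "\<exists>\<gamma>. gauge \<gamma> \<and> (\<forall>p. p tagged_division_of {a..b} \<and> \<gamma> fine p \<longrightarrow>
        norm ((\<Sum>(x, k)\<in>p. measure lborel k *\<^sub>R g x) - (f b - f a)) \<le> e * measure lborel {a..b})"
    proof (intro exI[of _ ?\<gamma>] conjI allI impI; (elim conjE)?)
      show "gauge ?\<gamma>"
        using U d(1) by (auto simp: gauge_def)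
      fix p assume p: "p tagged_division_of {a..b}" and fine: "?\<gamma> fine p"
      have pp: "p tagged_partial_division_of {a..b}" and fin: "finite p"
        using p tagged_division_of_finite by (auto simp: tagged_division_of_def)
      define q where "q = {y \<in> p. fst y \<in> N}"
      have q: "q tagged_partial_division_of {a..b}"
        by (rule tagged_partial_division_subset[OF pp]) (auto simp: q_def)
      have "(\<Sum>(x,K)\<in>q. measure lborel K) \<le> measure lebesgue U"
      proof (rule sum_content_tagged_partial_division_le[OF q U(3)])
        fix x K assume "(x, K) \<in> q"
        then show "K \<subseteq> U"
          using fineD[OF fine, of x K] by (simp add: q_def)
      qed
      then have qle: "(\<Sum>(x,K)\<in>q. \<bar>f (Sup K) - f (Inf K)\<bar>) < e/2 * (b - a)"
        using \<delta>[OF q] U(4) by linarith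
      have ba: "b - a = (\<Sum>(x,K)\<in>p. Sup K - Inf K)" "f b - f a = (\<Sum>(x,K)\<in>p. f(Sup K) - f(Inf K))"
        using additive_tagged_division_1[OF less_imp_le[OF \<open>a < b\<close>] p, of "\<lambda>x. x"]
          additive_tagged_division_1[OF less_imp_le[OF \<open>a < b\<close>] p, of f] by simp_all
      have "\<bar>\<Sum>(x, K)\<in>p. measure lborel K * g x - (f (Sup K) - f (Inf K))\<bar>
          \<le> (\<Sum>(x, K)\<in>p. \<bar>measure lborel K * g x - (f (Sup K) - f (Inf K))\<bar>)"
        unfolding split_def by (rule sum_abs)
      also have "\<dots> \<le> (\<Sum>(x, K)\<in>p. e/2 * (Sup K - Inf K)
                        + (if x \<in> N then \<bar>f (Sup K) - f (Inf K)\<bar> else 0))"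
      proof (rule sum_mono, clarify)
        fix x K assume xK: "(x, K) \<in> p"
        then obtain u v where K: "K = {u..v}" and x: "x \<in> K" and kab: "K \<subseteq> {a..b}"
          using tagged_division_ofD(2,3,4)[OF p xK] by auto
        have "u \<le> v" using x K by auto
        show "\<bar>measure lborel K * g x - (f (Sup K) - f (Inf K))\<bar>
          \<le> e/2 * (Sup K - Inf K) + (if x \<in> N then \<bar>f (Sup K) - f (Inf K)\<bar> else 0)"
        proof (cases "x \<in> N")
          case True
          then show ?thesis using \<open>u \<le> v\<close> \<open>e > 0\<close> by (simp add: g_def K abs_minus_commute)
        next
          case False
          then have sub: "K \<subseteq> ball x (d x)"
            using fineD[OF fine xK] by simp
          have *: "\<bar>f y - f x - (y-x) * f' x\<bar> \<le> e/2 * \<bar>y-x\<bar>" if "y \<in> K" for y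
            using that sub kab x False by (intro d(2)) (auto simp: dist_real_def abs_minus_commute)
          \<comment> \<open>The differentiability estimate is applied at both endpoints. Since the
            tag \<open>x\<close> lies between \<open>u\<close> and \<open>v\<close>, the two
            distances add up to \<open>v - u\<close>.\<close>
          have "\<bar>(v - u) * f' x - (f v - f u)\<bar> \<le> e/2 * \<bar>u-x\<bar> + e/2 * \<bar>v-x\<bar>"
          proof -
            have "(v - u) * f' x - (f v - f u)
              = (f u - f x - (u - x) * f' x) - (f v - f x - (v - x) * f' x)"
              by (simp add: algebra_simps)
            moreover have "u \<in> K" "v \<in> K" using \<open>u \<le> v\<close> K by auto
            ultimately show ?thesis
              using order_trans[OF abs_triangle_ineq4 add_mono[OF * *]] by metis
          qed
          also have "\<dots> = e/2 * (v - u)"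
            using x unfolding K by (simp flip: distrib_left)
          finally show ?thesis
            using False \<open>u \<le> v\<close> by (simp add: K g_def)
        qed
      qed
      also have "\<dots> = e/2 * (b - a) + (\<Sum>(x, K)\<in>q. \<bar>f (Sup K) - f (Inf K)\<bar>)"
        unfolding ba(1) q_def using fin
        by (simp add: split_def sum.distrib sum_distrib_left sum.inter_filter)
      also have "\<dots> \<le> e * (b - a)"
        using qle by (simp add: field_simps)
      finally show "norm ((\<Sum>(x, k)\<in>p. measure lborel k *\<^sub>R g x) - (f b - f a)) \<le> e * measure lborel {a..b}"
        using \<open>a < b\<close> by (simp add: ba(2) split_def sum_subtractf)
    qed
  qed
  then show ?thesis
    by (rule has_integral_spike[OF N, rotated]) (simp add: g_def)
qed

section \<open>Continuity, and a domination criterion for absolute continuity\<close>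

lemma abs_continuous_on_imp_continuous_on:
  assumes "abs_continuous_on a b f"
  shows "continuous_on {a..b} f"
  unfolding continuous_on_iff
proof (intro ballI allI impI)
  fix x e :: real assume x: "x \<in> {a..b}" and "e > 0"
  obtain d where "d > 0" and d: "\<And>(n::nat) l u.
        (\<And>i. i < n \<Longrightarrow> a \<le> l i \<and> l i \<le> u i \<and> u i \<le> b) \<Longrightarrow>
        (\<And>i j. i < n \<Longrightarrow> j < n \<Longrightarrow> i \<noteq> j \<Longrightarrow> {l i<..<u i} \<inter> {l j<..<u j} = {}) \<Longrightarrow>
        (\<Sum>i<n. u i - l i) < d \<Longrightarrow> (\<Sum>i<n. \<bar>f (u i) - f (l i)\<bar>) < e"
    by (rule abs_continuous_onE[OF assms \<open>e > 0\<close>]) blast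
  have "dist (f y) (f x) < e" if y: "y \<in> {a..b}" "dist y x < d" for y
    using d[of 1 "\<lambda>_. min x y" "\<lambda>_. max x y"] x y
    by (cases "x \<le> y") (auto simp: dist_real_def abs_minus_commute)
  then show "\<exists>d>0. \<forall>y\<in>{a..b}. dist y x < d \<longrightarrow> dist (f y) (f x) < e"
    using \<open>d > 0\<close> by blast
qed

text \<open>Each of the three summands of the bound receives a third of \<open>e\<close>. The
  criterion is meant for \<open>x1 t + (1 - t) * x2 t\<close>, where the linear term accounts for
  the variation of the factor \<open>1 - t\<close>.\<close>

lemma abs_continuous_on_dominated:
  assumes f: "abs_continuous_on a b f" and g: "abs_continuous_on a b g"
    and le: "\<And>s t. a \<le> s \<Longrightarrow> s \<le> t \<Longrightarrow> t \<le> b \<Longrightarrow>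
       \<bar>h t - h s\<bar> \<le> \<bar>f t - f s\<bar> + \<bar>g t - g s\<bar> + M * (t - s)"
  shows "abs_continuous_on a b h"
  unfolding abs_continuous_on_def
proof (intro allI impI)
  fix e :: real assume "e > 0"
  then have e3: "e / 3 > 0" by simp
  obtain d1 where "d1 > 0" and d1: "\<And>(n::nat) l u.
        (\<And>i. i < n \<Longrightarrow> a \<le> l i \<and> l i \<le> u i \<and> u i \<le> b) \<Longrightarrow>
        (\<And>i j. i < n \<Longrightarrow> j < n \<Longrightarrow> i \<noteq> j \<Longrightarrow> {l i<..<u i} \<inter> {l j<..<u j} = {}) \<Longrightarrow>
        (\<Sum>i<n. u i - l i) < d1 \<Longrightarrow> (\<Sum>i<n. \<bar>f (u i) - f (l i)\<bar>) < e/3"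
    by (rule abs_continuous_onE[OF f e3]) blast
  obtain d2 where "d2 > 0" and d2: "\<And>(n::nat) l u.
        (\<And>i. i < n \<Longrightarrow> a \<le> l i \<and> l i \<le> u i \<and> u i \<le> b) \<Longrightarrow>
        (\<And>i j. i < n \<Longrightarrow> j < n \<Longrightarrow> i \<noteq> j \<Longrightarrow> {l i<..<u i} \<inter> {l j<..<u j} = {}) \<Longrightarrow>
        (\<Sum>i<n. u i - l i) < d2 \<Longrightarrow> (\<Sum>i<n. \<bar>g (u i) - g (l i)\<bar>) < e/3"
    by (rule abs_continuous_onE[OF g e3]) blast
  \<comment> \<open>The divisor \<open>\<bar>M\<bar> + 1\<close> is positive and bounds
    \<open>M\<close> for every real \<open>M\<close>, including \<open>0\<close> and negative
    values.\<close>
  define d3 where "d3 = e / 3 / (\<bar>M\<bar> + 1)"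
  have "d3 > 0" using e3 by (simp add: d3_def)
  show "\<exists>\<delta>>0. \<forall>(n::nat) p q. (\<forall>i<n. a \<le> p i \<and> p i \<le> q i \<and> q i \<le> b) \<and>
        (\<forall>i<n. \<forall>j<n. i \<noteq> j \<longrightarrow> {p i<..<q i} \<inter> {p j<..<q j} = {}) \<and>
        (\<Sum>i<n. q i - p i) < \<delta> \<longrightarrow> (\<Sum>i<n. \<bar>h (q i) - h (p i)\<bar>) < e"
  proof (intro exI[of _ "min d1 (min d2 d3)"] conjI allI impI; (elim conjE)?)
    show "min d1 (min d2 d3) > 0"
      using \<open>d1 > 0\<close> \<open>d2 > 0\<close> \<open>d3 > 0\<close> by simp
    fix n :: nat and p q :: "nat \<Rightarrow> real"
    assume *: "\<forall>i<n. a \<le> p i \<and> p i \<le> q i \<and> q i \<le> b"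
        "\<forall>i<n. \<forall>j<n. i \<noteq> j \<longrightarrow> {p i<..<q i} \<inter> {p j<..<q j} = {}"
        "(\<Sum>i<n. q i - p i) < min d1 (min d2 d3)"
    have "(\<Sum>i<n. \<bar>f (q i) - f (p i)\<bar>) < e/3" "(\<Sum>i<n. \<bar>g (q i) - g (p i)\<bar>) < e/3"
      using * d1[of n p q] d2[of n p q] by auto
    moreover have "M * (\<Sum>i<n. q i - p i) < e/3"
    proof -
      have "0 \<le> (\<Sum>i<n. q i - p i)" using * by (intro sum_nonneg) auto
      then have "M * (\<Sum>i<n. q i - p i) \<le> (\<bar>M\<bar> + 1) * (\<Sum>i<n. q i - p i)"
        by (intro mult_right_mono) auto
      also have "\<dots> < (\<bar>M\<bar> + 1) * d3" using * by (intro mult_strict_left_mono) auto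
      also have "\<dots> = e/3"
      proof -
        have "\<bar>M\<bar> + 1 \<noteq> 0" by linarith
        then show ?thesis unfolding d3_def
          by (rule nonzero_mult_div_cancel_left[THEN trans[OF times_divide_eq_right]])
      qed
      finally show ?thesis .
    qed
    moreover have "(\<Sum>i<n. \<bar>h (q i) - h (p i)\<bar>)
        \<le> (\<Sum>i<n. \<bar>f (q i) - f (p i)\<bar> + \<bar>g (q i) - g (p i)\<bar> + M * (q i - p i))"
      using * by (intro sum_mono le) auto
    ultimately show "(\<Sum>i<n. \<bar>h (q i) - h (p i)\<bar>) < e"
      by (simp add: sum.distrib sum_distrib_left)
  qed
qed

section \<open>Moments of the controls and of the gap function\<close>

lemma set_A_moments:
  assumes "u \<in> set_A s0 sf v0 vf"
  shows "(u has_integral (vf - v0)) {0..1}"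
    and "((\<lambda>t. (1 - t) * u t) has_integral (sf - s0 - v0)) {0..1}"
proof -
  obtain x1 x2 where x: "abs_continuous_on 0 1 x1" "abs_continuous_on 0 1 x2"
    and d: "ae_derivative x1 x2" "ae_derivative x2 u"
    and bd: "x1 0 = s0" "x1 1 = sf" "x2 0 = v0" "x2 1 = vf"
    using assms by (auto simp: set_A_def W12_def)
  define N where "N = {t \<in> {0..1}. \<not> (x1 has_real_derivative x2 t) (at t within {0..1})}
    \<union> {t \<in> {0..1}. \<not> (x2 has_real_derivative u t) (at t within {0..1})}"
  have N: "negligible N"
    using d by (auto simp: N_def ae_derivative_def AE_lebesgue_on_negligible)
  have dN: "(x1 has_real_derivative x2 t) (at t within {0..1})"
    "(x2 has_real_derivative u t) (at t within {0..1})" if "t \<in> {0..1} - N" for t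
    using that by (auto simp: N_def)
  show "(u has_integral (vf - v0)) {0..1}"
    using fundamental_theorem_of_calculus_abs_continuous[OF _ x(2) N dN(2)] bd by simp

  \<comment> \<open>A bound on \<open>x2\<close> is the constant of the linear term in the
    domination of the auxiliary function below.\<close>
  have "compact (x2 ` {0..1})"
    using abs_continuous_on_imp_continuous_on[OF x(2)] compact_continuous_image compact_Icc by blast
  then obtain M where M: "\<And>t. t \<in> {0..1} \<Longrightarrow> \<bar>x2 t\<bar> \<le> M"
    by (force dest!: compact_imp_bounded simp: bounded_iff)
  \<comment> \<open>The auxiliary function \<open>z\<close> replaces an integration by parts: \<open>z' = (1 - t) u\<close> almost everywhere.\<close>
  define z where "z = (\<lambda>t. x1 t + (1 - t) * x2 t)"
  have "abs_continuous_on 0 1 z"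
  proof (rule abs_continuous_on_dominated[OF x])
    fix s t :: real assume st: "0 \<le> s" "s \<le> t" "t \<le> 1"
    have "z t - z s = (x1 t - x1 s) + (1 - t) * (x2 t - x2 s) - (t - s) * x2 s"
      by (simp add: z_def algebra_simps)
    moreover have "\<bar>(1 - t) * (x2 t - x2 s)\<bar> \<le> \<bar>x2 t - x2 s\<bar>"
      unfolding abs_mult using st by (intro mult_left_le_one_le) auto
    moreover have "\<bar>(t - s) * x2 s\<bar> \<le> M * (t - s)"
      using M[of s] st by (simp add: abs_mult mult.commute mult_right_mono)
    ultimately show "\<bar>z t - z s\<bar> \<le> \<bar>x1 t - x1 s\<bar> + \<bar>x2 t - x2 s\<bar> + M * (t - s)"
      by linarith
  qed
  \<comment> \<open>Outside \<open>N\<close> the derivative \<open>x2\<close> of \<open>x1\<close>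
    cancels against the term \<open>- x2\<close> from differentiating \<open>1 - t\<close>. The
    boundary values are \<open>z 1 = sf\<close> and \<open>z 0 = s0 + v0\<close>.\<close>
  then have "((\<lambda>t. (1 - t) * u t) has_integral (z 1 - z 0)) {0..1}"
    by (rule fundamental_theorem_of_calculus_abs_continuous[OF _ _ N, rotated])
      (auto simp: z_def intro!: derivative_eq_intros dN)
  then show "((\<lambda>t. (1 - t) * u t) has_integral (sf - s0 - v0)) {0..1}"
    by (simp add: z_def bd algebra_simps)
qed

lemma has_integral_bound_negligible:
  fixes f :: "real \<Rightarrow> real"
  assumes "0 \<le> B" "negligible N" "(f has_integral i) {0..1}"
    and "\<And>x. x \<in> {0..1} - N \<Longrightarrow> \<bar>f x\<bar> \<le> B"
  shows "\<bar>i\<bar> \<le> B"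
proof -
  have "((\<lambda>x. if x \<in> N then 0 else f x) has_integral i) (cbox 0 1)"
    using has_integral_spike[OF assms(2) _ assms(3), of "\<lambda>x. if x \<in> N then 0 else f x"] by simp
  then have "norm i \<le> B * measure lborel (cbox 0 (1::real))"
    using assms by (intro has_integral_bound) auto
  then show ?thesis by simp
qed

lemma gap_moments:
  assumes "0 < a" "uA \<in> set_A s0 sf v0 vf" "uB \<in> set_B a"
    and gap: "AE t in lebesgue_on {0..1}. uA t - uB t = c1 * t + c2"
  shows "\<bar>vf - v0 - (c1 / 2 + c2)\<bar> \<le> a"
    and "\<bar>sf - s0 - v0 - (c1 / 6 + c2 / 2)\<bar> \<le> a"
proof -
  \<comment> \<open>Almost everywhere \<open>uB\<close> equals \<open>uA\<close> minus the gap, so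
    the bound \<open>a\<close> passes to an expression whose moments are computable.\<close>
  have "AE t in lebesgue_on {0..1}. \<bar>uA t - (c1 * t + c2)\<bar> \<le> a"
  proof -
    have "AE t in lebesgue_on {0..1}. \<bar>uB t\<bar> \<le> a"
      using assms(3) by (simp add: set_B_def)
    with gap show ?thesis
      by eventually_elim (simp add: algebra_simps)
  qed
  then have N: "negligible {t\<in>{0..1}. \<not> \<bar>uA t - (c1 * t + c2)\<bar> \<le> a}" (is "negligible ?N")
    by (simp add: AE_lebesgue_on_negligible)
  have v: "((\<lambda>t. c1 * t + c2) has_integral (c1/2 + c2)) {0..1}"
  proof -
    have "((\<lambda>t. c1 * t\<^sup>2 / 2 + c2 * t) has_vector_derivative c1 * t + c2) (at t within {0..1})" for t
      by (auto simp flip: has_real_derivative_iff_has_vector_derivative intro!: derivative_eq_intros)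
    from fundamental_theorem_of_calculus[OF _ this] show ?thesis by simp
  qed
  have w: "((\<lambda>t. (1 - t) * (c1 * t + c2)) has_integral (c1/6 + c2/2)) {0..1}"
  proof -
    \<comment> \<open>The antiderivative comes from the expansion \<open>(1 - t) * (c1 * t + c2) =
      c2 + (c1 - c2) * t - c1 * t\<^sup>2\<close>.\<close>
    have "((\<lambda>t. (c1 - c2) * t\<^sup>2 / 2 + c2 * t - c1 * t ^ 3 / 3) has_vector_derivative
        (1 - t) * (c1 * t + c2)) (at t within {0..1})" for t
      by (auto simp: field_simps power2_eq_square
          simp flip: has_real_derivative_iff_has_vector_derivative intro!: derivative_eq_intros)
    from fundamental_theorem_of_calculus[OF _ this] show ?thesis
      by (simp add: field_simps)
  qed
  note I = has_integral_diff[OF set_A_moments(1)[OF assms(2)] v]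
    has_integral_diff[OF set_A_moments(2)[OF assms(2)] w]
  show "\<bar>vf - v0 - (c1 / 2 + c2)\<bar> \<le> a"
    by (rule has_integral_bound_negligible[OF _ N I(1)]) (use \<open>0 < a\<close> in auto)
  \<comment> \<open>The weight \<open>1 - t\<close> lies between \<open>0\<close> and
    \<open>1\<close>, so it preserves the bound \<open>a\<close>.\<close>
  show "\<bar>sf - s0 - v0 - (c1 / 6 + c2 / 2)\<bar> \<le> a"
  proof (rule has_integral_bound_negligible[OF _ N I(2)])
    fix t assume "t \<in> {0..1} - ?N"
    then have "\<bar>1 - t\<bar> * \<bar>uA t - (c1 * t + c2)\<bar> \<le> 1 * a"
      by (intro mult_mono) auto
    then show "\<bar>(1 - t) * uA t - (1 - t) * (c1 * t + c2)\<bar> \<le> a"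
      by (simp add: abs_mult flip: right_diff_distrib)
  qed (use \<open>0 < a\<close> in auto)
qed

section \<open>The switching time, and its limit under the switching equations\<close>

lemma switching_time_eq_root:
  assumes "c1 \<noteq> 0" "0 \<le> - c2 / c1" "- c2 / c1 \<le> 1"
  shows "switching_time c1 c2 = - c2 / c1"
\<comment> \<open>The description by \<open>THE\<close> excludes a root at \<open>0\<close>. For
  \<open>c2 = 0\<close> the conventional value \<open>0\<close> is still
  \<open>- c2 / c1\<close>.\<close>
proof (cases "c2 = 0")
  case False
  have root: "c1 * t + c2 = 0 \<longleftrightarrow> t = - c2 / c1" for t
    using assms(1) by (auto simp: field_simps)
  have "0 < - c2 / c1" using False assms(1,2) by (simp add: order_less_le)
  then have "(THE t. t \<in> {0<..1} \<and> c1 * t + c2 = 0) = - c2 / c1"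
    using assms unfolding root by (intro the_equality) auto
  then show ?thesis
    using False assms root by (auto simp: switching_time_def)
qed (simp add: switching_time_def)

text \<open>If \<open>c2 \<noteq> 0\<close>, a zero of the gap forces \<open>c1 \<noteq> 0\<close>,
  so the root is unique and the \<open>THE\<close> term denotes it. All other cases give
  \<open>0\<close> or \<open>1\<close> by convention.\<close>

lemma switching_time_bounds: "0 \<le> switching_time c1 c2 \<and> switching_time c1 c2 \<le> 1"
proof (cases "c2 \<noteq> 0 \<and> (\<exists>t\<in>{0..1}. c1 * t + c2 = 0)")
  case True
  then obtain t where t: "t \<in> {0..1}" "c1 * t + c2 = 0" by auto
  then have "c1 \<noteq> 0" using True by auto
  moreover have "t = - c2 / c1" using t \<open>c1 \<noteq> 0\<close> by (simp add: field_simps)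
  ultimately show ?thesis using switching_time_eq_root t by auto
qed (auto simp: switching_time_def)

text \<open>Since \<open>ts\<close> stays in the unit interval, every term containing
  \<open>r\<close> vanishes in the limit, whatever the sign of \<open>r\<close>.\<close>

lemma switching_equations_limit:
  fixes r c ts :: "real \<Rightarrow> real"
  assumes nondeg: "sf - s0 \<noteq> (v0 + vf) / 2"
    and bounds: "\<And>a. 0 \<le> ts a \<and> ts a \<le> 1"
    and r: "(r \<longlongrightarrow> 0) F"
    and eqs: "eventually (\<lambda>a. switching_equations s0 sf v0 vf (r a) (c a) (ts a)) F"
  shows "(ts \<longlongrightarrow> (2 * v0 + vf - 3 * (sf - s0)) / (3 * (v0 + vf) - 6 * (sf - s0))) F"
proof -
  \<comment> \<open>\<open>K\<close> is the value of \<open>c\<close> that the equations give for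
    \<open>r = 0\<close>; nondegeneracy says exactly that it is nonzero. \<open>E1\<close> and
    \<open>E2\<close> gather the terms in \<open>r\<close> that survive the elimination.\<close>
  define K where "K = 6 * (v0 + vf) - 12 * (sf - s0)"
  have "K \<noteq> 0" using nondeg by (simp add: K_def field_simps)
  define E1 where "E1 a = r a * (2 * ts a - 1)" for a
  define E2 where "E2 a = r a * (1/2 - (ts a)\<^sup>2)" for a
  have small: "((\<lambda>a. r a * g a) \<longlongrightarrow> 0) F" if "\<And>a. \<bar>g a\<bar> \<le> 1" for g
  proof (rule tendsto_rabs_zero_cancel, rule tendsto_sandwich[OF _ _ tendsto_const tendsto_rabs_zero[OF r]])
    show "\<forall>\<^sub>F a in F. \<bar>r a * g a\<bar> \<le> \<bar>r a\<bar>"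
      using that by (simp add: abs_mult mult_left_le)
  qed simp
  have E: "(E1 \<longlongrightarrow> 0) F" "(E2 \<longlongrightarrow> 0) F"
    unfolding E1_def E2_def
  proof (rule_tac [!] small)
    fix a
    have "(ts a)\<^sup>2 \<le> 1" "(ts a)\<^sup>2 \<ge> 0" using bounds[of a] by (auto simp: power_le_one)
    then show "\<bar>1/2 - (ts a)\<^sup>2\<bar> \<le> 1" "\<bar>2 * ts a - 1\<bar> \<le> 1"
      using bounds[of a] by linarith+
  qed
  let ?c = "\<lambda>a. K + 6 * E1 a + 12 * E2 a"
  let ?n = "\<lambda>a. ?c a / 2 + E1 a - (vf - v0)"
  have c: "c a = ?c a \<and> c a * ts a = ?n a"
    if "switching_equations s0 sf v0 vf (r a) (c a) (ts a)" for a
  proof -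
    have e1: "c a * ts a = c a / 2 + E1 a - (vf - v0)"
      using that unfolding switching_equations_def E1_def by (simp add: algebra_simps)
    have e2: "- c a * (ts a)\<^sup>2 + c a * ts a - c a / 3 + r a * (ts a)\<^sup>2 - r a * ts a + r a / 2
        - (vf - v0) * ts a + vf - (sf - s0) = 0"
      using that unfolding switching_equations_def by (simp add: algebra_simps)
    \<comment> \<open>Substituting this and then \<open>e1\<close> into \<open>e2\<close> leaves
      \<open>- c a / 12 + K / 12 + E1 a / 2 + E2 a = 0\<close>.\<close>
    have "c a * (ts a)\<^sup>2 = c a * ts a / 2 + E1 a * ts a - (vf - v0) * ts a"
      using arg_cong[OF e1, of "\<lambda>x. x * ts a"] by (simp add: algebra_simps power2_eq_square)
    moreover have "E1 a * ts a = 2 * (r a * (ts a)\<^sup>2) - r a * ts a" "E2 a = r a / 2 - r a * (ts a)\<^sup>2"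
      by (simp_all add: E1_def E2_def algebra_simps power2_eq_square)
    ultimately have "c a = ?c a"
      using e1 e2 unfolding K_def by argo
    then show ?thesis using e1 by simp
  qed
  have lim: "(?c \<longlongrightarrow> K + 6 * 0 + 12 * 0) F"
    by (intro tendsto_intros E)
  have "((\<lambda>a. ?n a / ?c a) \<longlongrightarrow> ((K + 6 * 0 + 12 * 0) / 2 + 0 - (vf - v0)) / (K + 6 * 0 + 12 * 0)) F"
    using \<open>K \<noteq> 0\<close> by (intro tendsto_divide tendsto_intros E lim) auto
  moreover have "eventually (\<lambda>a. ?c a \<noteq> 0) F"
    using tendsto_imp_eventually_ne[OF lim] \<open>K \<noteq> 0\<close> by simp
  then have "eventually (\<lambda>a. ?n a / ?c a = ts a) F"
    using eqs
  proof eventually_elim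
    case (elim a)
    then have "?c a * ts a = ?n a" using c[of a] by metis
    then show ?case using elim(1) by (simp add: divide_eq_eq mult.commute)
  qed
  ultimately have "(ts \<longlongrightarrow> (K / 2 - (vf - v0)) / K) F"
    by (simp add: tendsto_cong)
  moreover have "(K / 2 - (vf - v0)) / K =
      (2 * v0 + vf - 3 * (sf - s0)) / (3 * (v0 + vf) - 6 * (sf - s0))"
  proof -
    have "K / 2 - (vf - v0) = 2 * (2 * v0 + vf - 3 * (sf - s0))"
      and "K = 2 * (3 * (v0 + vf) - 6 * (sf - s0))"
      by (simp_all add: K_def field_simps)
    then show ?thesis by (metis mult_divide_mult_cancel_left zero_neq_numeral)
  qed
  ultimately show ?thesis by simp
qed

section \<open>The limit as \<open>a\<close> tends to \<open>0\<close> from the right\<close>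

lemma tendsto_of_abs_diff_le:
  fixes f :: "real \<Rightarrow> real"
  assumes "0 < ac" "\<And>a. 0 < a \<Longrightarrow> a < ac \<Longrightarrow> \<bar>L - f a\<bar> \<le> a"
  shows "(f \<longlongrightarrow> L) (at_right 0)"
proof (rule LIM_zero_cancel, rule tendsto_rabs_zero_cancel,
    rule tendsto_sandwich[OF _ _ tendsto_const tendsto_ident_at])
  show "\<forall>\<^sub>F a in at_right 0. \<bar>f a - L\<bar> \<le> a"
    using eventually_at_right_less[of "0::real"] eventually_at_right_real[OF \<open>0 < ac\<close>]
    by eventually_elim (use assms(2) in \<open>auto simp: abs_minus_commute\<close>)
qed simp

theorem corollary3:
  fixes s0 sf v0 vf ac :: real
    and uA uB :: "real \<Rightarrow> real \<Rightarrow> real"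
    and c1 c2 :: "real \<Rightarrow> real"
  assumes nondeg: "sf - s0 \<noteq> (v0 + vf) / 2"
    and crit: "critical_value s0 sf v0 vf ac"
    and best: "\<And>a. 0 < a \<Longrightarrow> a < ac \<Longrightarrow>
      best_approximation_pair (set_A s0 sf v0 vf) (set_B a) (uA a) (uB a)"
    and gap: "\<And>a. 0 < a \<Longrightarrow> a < ac \<Longrightarrow>
      (AE t in lebesgue_on {0..1}. uA a t - uB a t = c1 a * t + c2 a)"
    and eqs: "\<And>a. 0 < a \<Longrightarrow> a < ac \<Longrightarrow> v0 \<noteq> vf \<Longrightarrow>
      switching_equations s0 sf v0 vf (- sgn (slope (c1 a) (c2 a)) * a)
        (slope (c1 a) (c2 a)) (switching_time (c1 a) (c2 a))"
  shows "((\<lambda>a. switching_time (c1 a) (c2 a)) \<longlongrightarrow>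
      (2 * v0 + vf - 3 * (sf - s0)) / (3 * (v0 + vf) - 6 * (sf - s0))) (at_right 0)"
proof -
  have "0 < ac" using crit by (simp add: critical_value_def)
  show ?thesis
  proof (cases "v0 = vf")
    case False
    have ident: "((\<lambda>a. a) \<longlongrightarrow> (0::real)) (at_right 0)"
      by (rule tendsto_ident_at)
    show ?thesis
    proof (rule switching_equations_limit[OF nondeg switching_time_bounds])
      show "((\<lambda>a. - sgn (slope (c1 a) (c2 a)) * a) \<longlongrightarrow> 0) (at_right 0)"
      proof (rule Lim_null_comparison[OF _ tendsto_rabs_zero[OF ident]])
        show "\<forall>\<^sub>F a in at_right 0. norm (- sgn (slope (c1 a) (c2 a)) * a) \<le> \<bar>a\<bar>"
          by (simp add: abs_mult sgn_if)
      qed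
      show "\<forall>\<^sub>F a in at_right 0. switching_equations s0 sf v0 vf (- sgn (slope (c1 a) (c2 a)) * a)
          (slope (c1 a) (c2 a)) (switching_time (c1 a) (c2 a))"
        using eventually_at_right_real[OF \<open>0 < ac\<close>]
        by eventually_elim (use eqs False in auto)
    qed
  next
    case True
    define K where "K = sf - s0 - v0"
    have "K \<noteq> 0" using nondeg True by (simp add: K_def)
    have ab: "uA a \<in> set_A s0 sf v0 vf" "uB a \<in> set_B a" if "0 < a" "a < ac" for a
      using best[OF that] by (auto simp: best_approximation_pair_def)
    have m0: "((\<lambda>a. c1 a / 2 + c2 a) \<longlongrightarrow> 0) (at_right 0)"
      using gap_moments(1)[OF _ ab gap] True by (intro tendsto_of_abs_diff_le[OF \<open>0 < ac\<close>]) simp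
    have m1: "((\<lambda>a. c1 a / 6 + c2 a / 2) \<longlongrightarrow> K) (at_right 0)"
      using gap_moments(2)[OF _ ab gap] unfolding K_def
      by (intro tendsto_of_abs_diff_le[OF \<open>0 < ac\<close>]) simp
    \<comment> \<open>This combination of the two moments eliminates \<open>c2\<close> and equals
      \<open>c1\<close>.\<close>
    have "((\<lambda>a. 6 * (c1 a / 2 + c2 a) - 12 * (c1 a / 6 + c2 a / 2)) \<longlongrightarrow> 6 * 0 - 12 * K) (at_right 0)"
      by (intro tendsto_intros m0 m1)
    then have c1: "(c1 \<longlongrightarrow> - 12 * K) (at_right 0)"
      by simp
    \<comment> \<open>Here \<open>c2\<close> is written as the first moment minus
      \<open>c1 / 2\<close>, so that both limits already found apply.\<close>
    have "((\<lambda>a. - ((c1 a / 2 + c2 a) - c1 a / 2) / c1 a) \<longlongrightarrow> - (0 - (- 12 * K) / 2) / (- 12 * K)) (at_right 0)"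
      using \<open>K \<noteq> 0\<close> by (intro tendsto_intros m0 c1) auto
    then have lim: "((\<lambda>a. - c2 a / c1 a) \<longlongrightarrow> 1 / 2) (at_right 0)"
      using \<open>K \<noteq> 0\<close> by simp
    have "\<forall>\<^sub>F a in at_right 0. c1 a \<noteq> 0"
      using tendsto_imp_eventually_ne[OF c1] \<open>K \<noteq> 0\<close> by simp
    \<comment> \<open>The limit \<open>1/2\<close> is interior to the unit interval, so the gap
      eventually vanishes inside it and its root is the switching time.\<close>
    moreover have "\<forall>\<^sub>F a in at_right 0. - c2 a / c1 a > 0" "\<forall>\<^sub>F a in at_right 0. - c2 a / c1 a < 1"
      using order_tendstoD(1)[OF lim, of 0] order_tendstoD(2)[OF lim, of 1] by auto
    ultimately have "\<forall>\<^sub>F a in at_right 0. - c2 a / c1 a = switching_time (c1 a) (c2 a)"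
      by eventually_elim (auto simp: switching_time_eq_root)
    then have "((\<lambda>a. switching_time (c1 a) (c2 a)) \<longlongrightarrow> 1 / 2) (at_right 0)"
      by (rule Lim_transform_eventually[OF lim])
    \<comment> \<open>For \<open>v0 = vf\<close> the numerator is \<open>- 3 * K\<close> and the
      denominator \<open>- 6 * K\<close>.\<close>
    moreover have "(2 * v0 + vf - 3 * (sf - s0)) / (3 * (v0 + vf) - 6 * (sf - s0)) = 1 / 2"
      using \<open>K \<noteq> 0\<close> True by (simp add: K_def divide_eq_eq algebra_simps)
    ultimately show ?thesis by (simp only:)
  qed
qed

end
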